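(* For any rooted graph $G^u$, where $G$ is a nontrivial connected graph, and any positive integer $n$, we have $$\dim(G)\leq\dim(G^u\sqcap P_n^0)\leq|V(G)|-1.$$
   Context: All graphs are finite, simple and connected; the graph $G$ is nontrivial (at least two vertices). For a graph $H$, $d_H(u,v)$ is the distance between $u$ and $v$, and $R_H\{u,v\}=\{w\in V(H) : d_H(u,w)\neq d_H(v,w)\}$. A subset $W\subseteq V(H)$ is a resolving set of $H$ if $W\cap R_H\{u,v\}\neq\emptyset$ for any two distinct vertices $u,v$ of $H$. The metric dimension $\dim(H)$ is the minimum cardinality of a resolving set of $H$. A rooted graph $G^u$ is a graph $G$ with a distinguished vertex $u$, its root. The hierarchical product $G_2^{u_2}\sqcap G_1^{u_1}$ of rooted graphs is the rooted graph with vertex set $\{x_2x_1 : x_i\in V(G_i), i=1,2\}$ (pairs), root $u_2u_1$, in which $x_2x_1$ is adjacent to $y_2y_1$ whenever $x_2=y_2$ and $\{x_1,y_1\}\in E(G_1)$, or $x_1=y_1=u_1$ and $\{x_2,y_2\}\in E(G_2)$. The metric dimension of a rooted graph is that of the underlying graph. $P_n$ denotes the path on $n$ vertices $z_0=0,z_1,\ldots,z_{n-1}$ (with $z_i$ adjacent to $z_{i+1}$), and $0$ is one of its end-vertices; $P_n^0$ is $P_n$ rooted at $0$. For $n=1$, $P_1$ is a single vertex and $G^u\sqcap P_1^0$ is isomorphic to $G^u$. *)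

theory Defs
  imports "Graph_Theory.Graph_Theory"
begin

text \<open>
  A finite simple graph is a \<^locale>\<open>pair_graph\<close>: finite, loop-free and symmetric, with an edge
  \<open>{x, y}\<close> represented by the two arcs \<open>(x, y)\<close> and \<open>(y, x)\<close>.
\<close>

text \<open>
  The library's \<open>\<mu>\<close> is the infimum of the costs of all walks; with unit costs it is the
  length of a shortest walk.
\<close>

definition graph_dist :: "'a pair_pre_digraph \<Rightarrow> 'a \<Rightarrow> 'a \<Rightarrow> ereal" where
  "graph_dist H u v = wf_digraph.\<mu> (with_proj H) (\<lambda>_. 1) u v"

definition resolvers :: "'a pair_pre_digraph \<Rightarrow> 'a \<Rightarrow> 'a \<Rightarrow> 'a set" where
  "resolvers H u v = {w \<in> pverts H. graph_dist H u w \<noteq> graph_dist H v w}"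

definition resolving_set :: "'a pair_pre_digraph \<Rightarrow> 'a set \<Rightarrow> bool" where
  "resolving_set H W \<longleftrightarrow> W \<subseteq> pverts H \<and>
     (\<forall>u \<in> pverts H. \<forall>v \<in> pverts H. u \<noteq> v \<longrightarrow> W \<inter> resolvers H u v \<noteq> {})"

definition metric_dim :: "'a pair_pre_digraph \<Rightarrow> nat" where
  "metric_dim H = (LEAST k. \<exists>W. resolving_set H W \<and> card W = k)"

text \<open>A rooted graph is given by its underlying graph and its root.\<close>

type_synonym 'a rooted_graph = "'a pair_pre_digraph \<times> 'a"

definition hierarchical_product ::
    "'a rooted_graph \<Rightarrow> 'b rooted_graph \<Rightarrow> ('a \<times> 'b) rooted_graph" (infixr \<open>\<sqinter>\<^sub>h\<close> 70) where
  "hierarchical_product = (\<lambda>(G2, u2) (G1, u1).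
     (\<lparr> pverts = pverts G2 \<times> pverts G1,
        parcs = {((x2, x1), (y2, y1)).
           x2 \<in> pverts G2 \<and> y2 \<in> pverts G2 \<and> x1 \<in> pverts G1 \<and> y1 \<in> pverts G1 \<and>
           (x2 = y2 \<and> (x1, y1) \<in> parcs G1 \<or>
            x1 = u1 \<and> y1 = u1 \<and> (x2, y2) \<in> parcs G2)} \<rparr>,
      (u2, u1)))"

definition path_graph :: "nat \<Rightarrow> nat pair_pre_digraph" where
  "path_graph n = \<lparr> pverts = {..<n},
     parcs = {(i, j). i < n \<and> j < n \<and> (j = Suc i \<or> i = Suc j)} \<rparr>"

lemma pair_graph_path_graph: "pair_graph (path_graph n)"
proof -
  have "finite (parcs (path_graph n))"
    by (rule finite_subset[of _ "{..<n} \<times> {..<n}"]) (auto simp: path_graph_def)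
  then show ?thesis
    by unfold_locales (auto simp: path_graph_def symmetric_def sym_def)
qed

lemma pair_graph_hierarchical_product:
  assumes "pair_graph G2" "pair_graph G1"
  shows "pair_graph (fst ((G2, u2) \<sqinter>\<^sub>h (G1, u1)))"
proof -
  interpret G2: pair_graph G2 by fact
  interpret G1: pair_graph G1 by fact
  let ?P = "fst ((G2, u2) \<sqinter>\<^sub>h (G1, u1))"
  have fin: "finite (pverts ?P)"
    by (simp add: hierarchical_product_def)
  moreover have "finite (parcs ?P)"
    by (rule finite_subset[of _ "pverts ?P \<times> pverts ?P"])
       (use fin in \<open>auto simp: hierarchical_product_def\<close>)
  moreover have "symmetric ?P"
    using G1.pair_sym_arcs G2.pair_sym_arcs
    by (auto simp: hierarchical_product_def symmetric_def sym_def)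
  moreover have "fst e \<noteq> snd e" if "e \<in> parcs ?P" for e
    using that G1.pair_no_loops G2.pair_no_loops
    by (force simp: hierarchical_product_def)
  moreover have "fst e \<in> pverts ?P \<and> snd e \<in> pverts ?P" if "e \<in> parcs ?P" for e
    using that by (auto simp: hierarchical_product_def)
  ultimately show ?thesis
    by unfold_locales auto
qed

end

theory Submission
  imports Defs
begin

text \<open>
  In \<open>G\<^sup>u \<sqinter> P\<^sub>n\<^sup>0\<close> a copy of the path \<open>P\<^sub>n\<close> hangs at every vertex of \<open>G\<close>, and a walk from one of
  these paths to another one has to go down to level \<open>0\<close>, cross \<open>G\<close>, and climb again. Hence
  \<open>d((h, j), (g, i)) = j + d\<^sub>G(h, g) + i\<close> if \<open>h \<noteq> g\<close>, and \<open>\<bar>j - i\<bar>\<close> if \<open>h = g\<close>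
  (\<open>distance_to_hierarchical_product\<close>). Both inequalities follow from this formula.

  For the lower bound, let \<open>W\<close> resolve the product. Two vertices \<open>(x, 0)\<close> and \<open>(y, 0)\<close> at level
  \<open>0\<close> have distances \<open>d\<^sub>G(x, g) + i\<close> and \<open>d\<^sub>G(y, g) + i\<close> to \<open>(g, i)\<close>, so if \<open>(g, i)\<close> separates them
  then \<open>g\<close> separates \<open>x\<close> and \<open>y\<close> in \<open>G\<close>. The projection of \<open>W\<close> to \<open>G\<close>, which is not larger
  than \<open>W\<close>, is thus a resolving set of \<open>G\<close>.

  For the upper bound, take the far ends of all but one of the hanging paths. The far end over \<open>g\<close>
  is at distance \<open>n - 1 - i\<close> from \<open>(g, i)\<close>, and at distance at least \<open>n\<close> from every vertex over a
  different \<open>h\<close>; so it separates the vertices over \<open>g\<close> from all others. Two vertices over the same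
  \<open>g\<close> differ in their level, which every far end detects.
\<close>

section \<open>Certificates for distances\<close>

text \<open>
  A function that vanishes at \<open>w\<close>, drops by at most one along every arc, and can be made to drop by
  exactly one from every vertex other than \<open>w\<close>, is the distance to \<open>w\<close>. Distances in the product
  are computed by checking these three local conditions, without handling walks.
\<close>

definition distance_to :: "'a pair_pre_digraph \<Rightarrow> 'a \<Rightarrow> ('a \<Rightarrow> nat) \<Rightarrow> bool" where
  "distance_to H w f \<longleftrightarrow> f w = 0 \<and>
     (\<forall>x y. (x, y) \<in> parcs H \<longrightarrow> f x \<le> Suc (f y)) \<and>
     (\<forall>x \<in> pverts H. x \<noteq> w \<longrightarrow> (\<exists>y. (x, y) \<in> parcs H \<and> f x = Suc (f y)))"

lemma (in wf_digraph) awalk_cost_unit: "awalk_cost (\<lambda>_. 1) p = real (length p)"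
  by (induction p) simp_all

text \<open>
  The slow decrease of \<open>f\<close> bounds the length of every walk to \<open>w\<close> from below; always following a
  descending arc gives a walk that attains the bound.
\<close>

lemma graph_dist_distance_to:
  assumes wf: "pair_wf_digraph H" and w: "w \<in> pverts H" and f: "distance_to H w f"
    and x: "x \<in> pverts H"
  shows "graph_dist H x w = ereal (real (f x))"
proof -
  interpret H: pair_wf_digraph H by fact
  have lower: "f x \<le> length p" if "H.awalk x p w" for p
    using that
  proof (induction p arbitrary: x)
    case Nil
    then show ?case
      using f by (simp add: H.awalk_Nil_iff distance_to_def)
  next
    case (Cons e p)
    then have e: "(x, snd e) \<in> parcs H" and "H.awalk (snd e) p w"
      by (auto simp: H.awalk_Cons_iff)
    then have "f (snd e) \<le> length p"
      using Cons.IH by blast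
    moreover have "f x \<le> Suc (f (snd e))"
      using f e by (auto simp: distance_to_def)
    ultimately show ?case by simp
  qed
  have "\<exists>p. H.awalk x p w \<and> length p = f x"
    using x
  proof (induction "f x" arbitrary: x)
    case 0
    then have "x = w"
      using f by (force simp: distance_to_def)
    then show ?case
      using 0 by (auto simp: H.awalk_Nil_iff)
  next
    case (Suc k)
    then have "x \<noteq> w"
      using f by (auto simp: distance_to_def)
    then obtain y where y: "(x, y) \<in> parcs H" "f x = Suc (f y)"
      using f Suc.prems by (auto simp: distance_to_def)
    then obtain p where "H.awalk y p w" "length p = f y"
      using Suc.hyps H.in_arcsD2 by (metis nat.inject)
    then have "H.awalk x ((x, y) # p) w" "length ((x, y) # p) = f x"
      using y by (auto simp: H.awalk_Cons_iff)
    then show ?case by blast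
  qed
  then obtain p where p: "H.awalk x p w" "length p = f x" by blast
  show ?thesis
    unfolding graph_dist_def
  proof (rule antisym)
    show "H.\<mu> (\<lambda>_. 1) x w \<le> ereal (real (f x))"
      using H.min_cost_le_walk_cost[OF p(1), of "\<lambda>_. 1"] p(2) by (simp add: H.awalk_cost_unit)
    show "ereal (real (f x)) \<le> H.\<mu> (\<lambda>_. 1) x w"
      unfolding H.\<mu>_def using lower by (auto simp: H.awalk_cost_unit intro!: INF_greatest)
  qed
qed

text \<open>
  Conversely, the length of a shortest walk to \<open>w\<close> is a certificate: prepending an arc to such a
  walk shows that the length drops by at most one along this arc, and the first arc of such a walk
  descends. Connectedness provides a walk to \<open>w\<close> from every vertex.
\<close>

lemma ex_distance_to:
  assumes graph: "pair_graph G" and conn: "connected (with_proj G)" and w: "w \<in> pverts G"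
  shows "\<exists>f. distance_to G w f"
proof -
  interpret G: pair_graph G by fact
  define f where "f x = (LEAST k. \<exists>p. G.awalk x p w \<and> length p = k)" for x
  have f_le: "f x \<le> length p" if "G.awalk x p w" for x p
    unfolding f_def by (rule Least_le) (use that in blast)
  have shortest: "\<exists>p. G.awalk x p w \<and> length p = f x" if x: "x \<in> pverts G" for x
  proof -
    have "strongly_connected (with_proj G)"
      using G.symmetric_connected_imp_strongly_connected G.sym_arcs conn by blast
    then obtain p where walk: "G.awalk x p w"
      using x w unfolding strongly_connected_def G.reachable_awalk by auto
    show ?thesis
      unfolding f_def by (rule LeastI_ex) (use walk in blast)
  qed
  have step: "f x \<le> Suc (f y)" if xy: "(x, y) \<in> parcs G" for x y
  proof -
    obtain p where p: "G.awalk y p w" "length p = f y"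
      using shortest G.in_arcsD2[OF xy] by blast
    then have "G.awalk x ((x, y) # p) w"
      using xy G.in_arcsD1 by (auto simp: G.awalk_Cons_iff)
    from f_le[OF this] p(2) show ?thesis by simp
  qed
  have descent: "\<exists>y. (x, y) \<in> parcs G \<and> f x = Suc (f y)" if x: "x \<in> pverts G" "x \<noteq> w" for x
  proof -
    obtain p where p: "G.awalk x p w" "length p = f x"
      using shortest x(1) by blast
    then obtain e q where eq: "p = e # q"
      using x(2) by (cases p) (auto simp: G.awalk_Nil_iff)
    then have e: "(x, snd e) \<in> parcs G" and "G.awalk (snd e) q w"
      using p(1) by (auto simp: G.awalk_Cons_iff)
    then have "Suc (f (snd e)) \<le> f x"
      using f_le p(2) eq by fastforce
    then show ?thesis
      using step[OF e] e by (intro exI[of _ "snd e"]) auto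
  qed
  have "f w = 0"
    using f_le[of w "[]"] w by (simp add: G.awalk_Nil_iff)
  then show ?thesis
    using step descent unfolding distance_to_def by blast
qed

section \<open>Distances in the hierarchical product with a path\<close>

lemma pverts_product_path [simp]:
  "pverts (fst ((G, u) \<sqinter>\<^sub>h (path_graph n, r))) = pverts G \<times> {..<n}"
  by (simp add: hierarchical_product_def path_graph_def)

lemma parcs_product_path:
  "((x, i), (y, j)) \<in> parcs (fst ((G, u) \<sqinter>\<^sub>h (path_graph n, r))) \<longleftrightarrow>
     x \<in> pverts G \<and> y \<in> pverts G \<and> i < n \<and> j < n \<and>
     (x = y \<and> (j = Suc i \<or> i = Suc j) \<or> i = r \<and> j = r \<and> (x, y) \<in> parcs G)"
  by (auto simp: hierarchical_product_def path_graph_def)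

text \<open>
  In the first branch, one of the two truncated differences of the levels is zero and the other one
  is the absolute value of their difference.
\<close>

definition product_path_dist :: "('a \<Rightarrow> nat) \<Rightarrow> 'a \<times> nat \<Rightarrow> 'a \<times> nat \<Rightarrow> nat" where
  "product_path_dist f w x =
     (if fst x = fst w then (snd x - snd w) + (snd w - snd x) else snd x + f (fst x) + snd w)"

text \<open>
  On the path over \<open>g\<close> the descending step leads towards level \<open>i\<close>. Elsewhere it leads down the
  path, and at level \<open>0\<close> it is a descending step for the distance to \<open>g\<close> in \<open>G\<close>; since
  \<open>\<bar>0 - i\<bar> = 0 + f g + i\<close>, the two branches of the formula agree where this step enters the path
  over \<open>g\<close>.
\<close>

lemma distance_to_hierarchical_product:
  assumes f: "distance_to G g f" and g: "g \<in> pverts G" and i: "i < n" and wf: "pair_wf_digraph G"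
  shows "distance_to (fst ((G, u) \<sqinter>\<^sub>h (path_graph n, 0))) (g, i) (product_path_dist f (g, i))"
proof -
  interpret G: pair_wf_digraph G by fact
  let ?P = "fst ((G, u) \<sqinter>\<^sub>h (path_graph n, 0))" and ?F = "product_path_dist f (g, i)"
  have fg: "f g = 0"
    and f_step: "\<And>x y. (x, y) \<in> parcs G \<Longrightarrow> f x \<le> Suc (f y)"
    and f_descent: "\<And>x. x \<in> pverts G \<Longrightarrow> x \<noteq> g \<Longrightarrow> \<exists>y. (x, y) \<in> parcs G \<and> f x = Suc (f y)"
    using f by (auto simp: distance_to_def)
  have F_root: "?F (x, 0) = f x + i" for x
    using fg by (auto simp: product_path_dist_def)
  have step: "?F (x, j) \<le> Suc (?F (y, k))" if "((x, j), (y, k)) \<in> parcs ?P" for x j y k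
  proof -
    consider "x = y" "k = Suc j \<or> j = Suc k" | "j = 0" "k = 0" "(x, y) \<in> parcs G"
      using \<open>((x, j), (y, k)) \<in> parcs ?P\<close> unfolding parcs_product_path by blast
    then show ?thesis
    proof cases
      case 1
      then show ?thesis by (auto simp: product_path_dist_def)
    next
      case 2
      then show ?thesis using f_step by (simp add: F_root)
    qed
  qed
  have descent: "\<exists>y. ((x, j), y) \<in> parcs ?P \<and> ?F (x, j) = Suc (?F y)"
    if x: "x \<in> pverts G" and j: "j < n" and ne: "(x, j) \<noteq> (g, i)" for x j
  proof -
    consider "x = g" "j < i" | "x = g" "j > i" | "x \<noteq> g" "j = 0" | "x \<noteq> g" "j > 0"
      using ne by fastforce
    then show ?thesis
    proof cases
      case 1
      then show ?thesis
        using x i by (intro exI[of _ "(g, Suc j)"])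
          (auto simp: parcs_product_path product_path_dist_def)
    next
      case 2
      then show ?thesis
        using x j by (intro exI[of _ "(g, j - 1)"])
          (auto simp: parcs_product_path product_path_dist_def)
    next
      case 3
      then obtain y where y: "(x, y) \<in> parcs G" "f x = Suc (f y)"
        using f_descent x by blast
      then have "((x, j), (y, 0)) \<in> parcs ?P"
        using 3 x j G.in_arcsD2 by (auto simp: parcs_product_path)
      then show ?thesis
        using 3 y(2) F_root by (intro exI[of _ "(y, 0)"]) simp
    next
      case 4
      then show ?thesis
        using x j by (intro exI[of _ "(x, j - 1)"])
          (auto simp: parcs_product_path product_path_dist_def)
    qed
  qed
  have "?F (g, i) = 0"
    by (simp add: product_path_dist_def)
  then show ?thesis
    unfolding distance_to_def using step descent by (auto simp del: fst_conv)
qed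

section \<open>Resolving sets of the product\<close>

lemma resolvers_commute: "resolvers H x y = resolvers H y x"
  by (auto simp: resolvers_def)

lemma resolving_set_finite:
  assumes "finite (pverts H)" "resolving_set H W"
  shows "finite W"
  using assms finite_subset by (auto simp: resolving_set_def)

lemma metric_dim_le_card:
  "resolving_set H W \<Longrightarrow> metric_dim H \<le> card W"
  unfolding metric_dim_def by (rule Least_le) blast

lemma ex_metric_basis:
  assumes "resolving_set H W"
  shows "\<exists>B. resolving_set H B \<and> card B = metric_dim H"
  unfolding metric_dim_def by (rule LeastI_ex) (use assms in blast)

text \<open>
  The locale fixes a distance certificate for every vertex of \<open>G\<close>, so that all distances below are
  natural numbers instead of extended reals.
\<close>

locale hanging_paths =
  fixes G :: "'a pair_pre_digraph" and u :: 'a and n :: nat and d :: "'a \<Rightarrow> 'a \<Rightarrow> nat"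
  assumes graph: "pair_graph G" and n_pos: "n \<ge> 1"
    and d: "\<And>g. g \<in> pverts G \<Longrightarrow> distance_to G g (d g)"
begin

abbreviation prod_graph :: "('a \<times> nat) pair_pre_digraph" where
  "prod_graph \<equiv> fst ((G, u) \<sqinter>\<^sub>h (path_graph n, 0))"

lemma wf_G: "pair_wf_digraph G"
  using graph pair_graph_def pair_digraph_def pair_fin_digraph_def by blast

lemma wf_prod: "pair_wf_digraph prod_graph"
  using pair_graph_hierarchical_product[OF graph pair_graph_path_graph]
    pair_graph_def pair_digraph_def pair_fin_digraph_def by blast

lemma finite_G: "finite (pverts G)"
  using graph pair_graph_def pair_digraph_def pair_fin_digraph.pair_finite_verts by blast

lemma graph_dist_G:
  "g \<in> pverts G \<Longrightarrow> x \<in> pverts G \<Longrightarrow> graph_dist G x g = ereal (real (d g x))"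
  using graph_dist_distance_to[OF wf_G] d by blast

lemma graph_dist_prod:
  assumes "w \<in> pverts prod_graph" "x \<in> pverts prod_graph"
  shows "graph_dist prod_graph x w = ereal (real (product_path_dist (d (fst w)) w x))"
proof -
  obtain g i where w: "w = (g, i)" by fastforce
  then have "distance_to prod_graph w (product_path_dist (d (fst w)) w)"
    using distance_to_hierarchical_product[OF d _ _ wf_G] assms(1) by simp
  then show ?thesis
    using graph_dist_distance_to[OF wf_prod] assms by blast
qed

text \<open>
  Separation of \<open>(x, 0)\<close> and \<open>(y, 0)\<close> already takes place in \<open>G\<close>: the level of the separating
  vertex contributes the same summand to both distances, even if that vertex lies over \<open>x\<close> or \<open>y\<close>.
\<close>

lemma projection_resolving_set:
  assumes W: "resolving_set prod_graph W"
  shows "resolving_set G (fst ` W)"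
  unfolding resolving_set_def
proof (intro conjI ballI impI)
  show "fst ` W \<subseteq> pverts G"
    using W by (auto simp: resolving_set_def)
  fix x y assume xy: "x \<in> pverts G" "y \<in> pverts G" "x \<noteq> y"
  then have mem: "(x, 0) \<in> pverts prod_graph" "(y, 0) \<in> pverts prod_graph"
    using n_pos by auto
  moreover have "(x, 0::nat) \<noteq> (y, 0)"
    using xy(3) by simp
  ultimately have "W \<inter> resolvers prod_graph (x, 0) (y, 0) \<noteq> {}"
    using W unfolding resolving_set_def by blast
  then obtain g i where gi: "(g, i) \<in> W" "(g, i) \<in> resolvers prod_graph (x, 0) (y, 0)"
    by auto
  then have verts: "(g, i) \<in> pverts prod_graph"
    by (simp add: resolvers_def)
  then have g: "g \<in> pverts G" by simp
  then have "d g g = 0"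
    using d by (simp add: distance_to_def)
  then have "product_path_dist (d g) (g, i) (z, 0) = d g z + i" for z
    by (simp add: product_path_dist_def)
  then have "d g x \<noteq> d g y"
    using gi(2) graph_dist_prod[OF verts mem(1)] graph_dist_prod[OF verts mem(2)]
    by (auto simp: resolvers_def)
  then have "g \<in> resolvers G x y"
    using g xy by (simp add: resolvers_def graph_dist_G)
  then show "fst ` W \<inter> resolvers G x y \<noteq> {}"
    using gi(1) by force
qed

lemma far_end_separates:
  assumes g: "g \<in> pverts G" and h: "h \<in> pverts G" "h \<noteq> g" and ij: "i < n" "j < n"
  shows "(g, n - 1) \<in> resolvers prod_graph (g, i) (h, j)"
proof -
  \<comment> \<open>The vertex over \<open>h\<close> has to cross at least one edge of \<open>G\<close> and climb the whole path.\<close>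
  have "d g h > 0"
    using d[OF g] h by (force simp: distance_to_def)
  then have "product_path_dist (d g) (g, n - 1) (g, i)
      \<noteq> product_path_dist (d g) (g, n - 1) (h, j)"
    using h(2) ij by (simp add: product_path_dist_def)
  then show ?thesis
    using g h ij graph_dist_prod by (simp add: resolvers_def)
qed

lemma far_end_separates_levels:
  assumes g: "g \<in> pverts G" and h: "h \<in> pverts G" and ij: "i < n" "j < n" "i \<noteq> j"
  shows "(h, n - 1) \<in> resolvers prod_graph (g, i) (g, j)"
proof -
  have "product_path_dist (d h) (h, n - 1) (g, i) \<noteq> product_path_dist (d h) (h, n - 1) (g, j)"
    using ij by (auto simp: product_path_dist_def)
  then show ?thesis
    using g h ij graph_dist_prod by (simp add: resolvers_def)
qed

text \<open>
  Of two vertices over different vertices of \<open>G\<close>, at least one does not lie over \<open>r\<close>, and the far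
  end of its path separates them. For two vertices over the same vertex any far end will do, and
  one is left because \<open>G\<close> is nontrivial.
\<close>

lemma far_ends_resolving_set:
  assumes r: "r \<in> pverts G" and card: "card (pverts G) \<ge> 2"
  shows "resolving_set prod_graph ((pverts G - {r}) \<times> {n - 1})"
  unfolding resolving_set_def
proof (intro conjI ballI impI)
  let ?W = "(pverts G - {r}) \<times> {n - 1}"
  show "?W \<subseteq> pverts prod_graph"
    using n_pos by auto
  fix x y assume x: "x \<in> pverts prod_graph" and y: "y \<in> pverts prod_graph" and ne: "x \<noteq> y"
  obtain g i h j where xy: "x = (g, i)" "y = (h, j)"
    by fastforce
  have mem: "g \<in> pverts G" "h \<in> pverts G" "i < n" "j < n"
    using x y xy by auto
  consider "g = h" "i \<noteq> j" | "g \<noteq> h" "g \<noteq> r" | "g \<noteq> h" "h \<noteq> r"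
    using ne xy by auto
  then show "?W \<inter> resolvers prod_graph x y \<noteq> {}"
  proof cases
    case 1
    have "card (pverts G - {r}) > 0"
      using r card finite_G by simp
    then obtain v where "v \<in> pverts G - {r}"
      by (metis card_gt_0_iff ex_in_conv)
    then show ?thesis
      using far_end_separates_levels[of g v i j] 1 mem xy by blast
  next
    case 2
    then show ?thesis
      using far_end_separates[of g h i j] mem xy by blast
  next
    case 3
    then have "(h, n - 1) \<in> resolvers prod_graph x y"
      using far_end_separates[of h g j i] mem xy by (simp add: resolvers_commute[of _ "(g, i)"])
    then show ?thesis
      using 3 mem by blast
  qed
qed

end

theorem proposition2p11:
  fixes G :: "'a pair_pre_digraph" and u :: 'a and n :: nat
  assumes "pair_graph G" and "connected (with_proj G)" and "card (pverts G) \<ge> 2"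
    and "u \<in> pverts G" and "n \<ge> 1"
  shows "metric_dim G \<le> metric_dim (fst ((G, u) \<sqinter>\<^sub>h (path_graph n, 0))) \<and>
         metric_dim (fst ((G, u) \<sqinter>\<^sub>h (path_graph n, 0))) \<le> card (pverts G) - 1"
proof -
  have "\<forall>g \<in> pverts G. \<exists>f. distance_to G g f"
    using ex_distance_to[OF assms(1,2)] by blast
  then obtain d where d: "\<forall>g \<in> pverts G. distance_to G g (d g)"
    by (rule bchoice[THEN exE])
  interpret hanging_paths G u n d
    by (rule hanging_paths.intro) (use assms d in auto)
  \<comment> \<open>Any vertex of \<open>G\<close> may be the one whose far end is left out; the root is at hand.\<close>
  let ?W = "(pverts G - {u}) \<times> {n - 1}"
  have W: "resolving_set prod_graph ?W"
    using far_ends_resolving_set assms by blast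
  have "card ?W = card (pverts G) - 1"
    using assms(4) finite_G by (simp add: card_cartesian_product)
  then have upper: "metric_dim prod_graph \<le> card (pverts G) - 1"
    using metric_dim_le_card[OF W] by simp
  obtain B where B: "resolving_set prod_graph B" "card B = metric_dim prod_graph"
    using ex_metric_basis[OF W] by blast
  have "finite B"
    using resolving_set_finite[OF _ B(1)] finite_G by simp
  then have "card (fst ` B) \<le> metric_dim prod_graph"
    using card_image_le B(2) by metis
  then have "metric_dim G \<le> metric_dim prod_graph"
    using metric_dim_le_card[OF projection_resolving_set[OF B(1)]] by linarith
  then show ?thesis
    using upper by blast
qed

end
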